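(* Let $\mathcal{M} \subset \Delta_{n-1}$ be any finite statistical model (a finite subset of $\Delta_{n-1}$). Then for each $p \in \mathcal{M}$ the logarithmic Voronoi cell $\log \mathrm{Vor}_{\mathcal{M}}(p)$ is a polytope, up to points in the boundary of the simplex; that is, $\log \mathrm{Vor}_{\mathcal{M}}(p)$ is the intersection of a polytope in $\mathbb{R}^n$ with the open simplex $\Delta_{n-1}$.
   Context: $\Delta_{n-1} = \{u \in \mathbb{R}^n : \sum_{i=1}^n u_i = 1,\ u_i > 0 \text{ for all } i\}$ is the open probability simplex. For $u \in \Delta_{n-1}$ let $\ell_u(q) = \sum_{i=1}^n u_i \log(q_i)$. Write $\Phi(u)=p$ if $p \in \mathcal{M}$ and $p \in \operatorname{argmax}_{q \in \mathcal{M}} \ell_u(q)$ (ties allowed). The logarithmic Voronoi cell of $p \in \mathcal{M}$ is $\log \mathrm{Vor}_{\mathcal{M}}(p) = \{u \in \Delta_{n-1} : \Phi(u) = p\}$, i.e. the set of $u \in \Delta_{n-1}$ with $\ell_u(p) \ge \ell_u(q)$ for all $q \in \mathcal{M}$. *)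

theory Defs
  imports "HOL-Analysis.Analysis"
begin

definition open_simplex :: "(real ^ 'n) set" where
  "open_simplex = {u. (\<Sum>i\<in>UNIV. u $ i) = 1 \<and> (\<forall>i. u $ i > 0)}"

definition log_likelihood :: "real ^ 'n \<Rightarrow> real ^ 'n \<Rightarrow> real" where
  "log_likelihood u q = (\<Sum>i\<in>UNIV. u $ i * ln (q $ i))"

(* The multivalued map Phi (ties allowed) is a relation: Phi(u) = p is rendered as is_mle M u p. *)
definition is_mle :: "(real ^ 'n) set \<Rightarrow> real ^ 'n \<Rightarrow> real ^ 'n \<Rightarrow> bool" where
  "is_mle M u p \<longleftrightarrow> is_arg_max (log_likelihood u) (\<lambda>q. q \<in> M) p"

definition log_voronoi_cell :: "(real ^ 'n) set \<Rightarrow> real ^ 'n \<Rightarrow> (real ^ 'n) set" where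
  "log_voronoi_cell M p = {u \<in> open_simplex. is_mle M u p}"

end

theory Submission
  imports Defs
begin

text \<open>
  For fixed \<open>q\<close>, the log-likelihood is linear in the data \<open>u\<close>: it is the inner product of \<open>u\<close>
  with the vector of logarithms of \<open>q\<close>. Hence the data vectors for which \<open>p\<close> is at least as
  likely as a competitor \<open>q\<close> form a closed half-space (all of space when \<open>q = p\<close>),
  and because the model is finite, the cell is cut out of the open simplex by finitely many half-spaces. Their intersection is only a polyhedron, but the open
  simplex lies in the unit cube, so intersecting with that cube makes it bounded, hence a
  polytope, without changing its trace on the open simplex.
\<close>

lemma log_likelihood_eq_inner: "log_likelihood u q = (\<chi> i. ln (q $ i)) \<bullet> u"
  by (simp add: log_likelihood_def inner_vec_def mult.commute)

lemma polyhedron_log_likelihood_le: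
  "polyhedron {u. log_likelihood u q \<le> log_likelihood u p}"
proof -
  have "{u. log_likelihood u q \<le> log_likelihood u p}
      = {u. ((\<chi> i. ln (q $ i)) - (\<chi> i. ln (p $ i))) \<bullet> u \<le> 0}"
    by (simp add: log_likelihood_eq_inner inner_diff_left)
  then show ?thesis
    by (simp only: polyhedron_halfspace_le)
qed

lemma open_simplex_subset_unit_cube: "open_simplex \<subseteq> cbox (0 :: real ^ 'n) 1"
proof
  fix u :: "real ^ 'n"
  assume "u \<in> open_simplex"
  then have sum: "(\<Sum>i\<in>UNIV. u $ i) = 1" and pos: "\<And>i. 0 < u $ i"
    by (auto simp: open_simplex_def)
  have "u $ i \<le> 1" for i
    using member_le_sum[of i UNIV "\<lambda>i. u $ i"] sum pos by (simp add: less_imp_le)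
  with pos show "u \<in> cbox 0 1"
    by (simp add: mem_box_cart less_imp_le)
qed

lemma log_voronoi_cell_eq:
  assumes "p \<in> M"
  shows "log_voronoi_cell M p
    = (\<Inter>q\<in>M. {u. log_likelihood u q \<le> log_likelihood u p}) \<inter> open_simplex"
  using assms by (auto simp: log_voronoi_cell_def is_mle_def is_arg_max_linorder)

theorem proposition2:
  fixes M :: "(real ^ 'n) set" and p :: "real ^ 'n"
  assumes "finite M" and "M \<subseteq> open_simplex" and "p \<in> M"
  shows "\<exists>P :: (real ^ 'n) set. polytope P \<and> log_voronoi_cell M p = P \<inter> open_simplex"
proof (intro exI conjI)
  let ?H = "\<Inter>q\<in>M. {u. log_likelihood u q \<le> log_likelihood u p}"
  have "polyhedron ?H"
    using \<open>finite M\<close> by (auto intro!: polyhedron_Inter polyhedron_log_likelihood_le)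
  then show "polytope (cbox 0 1 \<inter> ?H)"
    by (simp add: polytope_Int_polyhedron polytope_interval)
  show "log_voronoi_cell M p = (cbox 0 1 \<inter> ?H) \<inter> open_simplex"
    using log_voronoi_cell_eq[OF \<open>p \<in> M\<close>] open_simplex_subset_unit_cube by blast
qed

end
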